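(* Let $\mathcal{D}[t]\hookrightarrow\mathcal{H}\hookrightarrow\mathcal{D}^\times[t^\times]$ be a rigged Hilbert space, let $(X,\mu)$ be a measure space with $\mu$ a $\sigma$-finite positive measure, let $\omega: x\in X\mapsto\omega_x\in\mathcal{D}^\times$ be a weakly measurable map and let $\theta: x\in X\mapsto\theta_x\in\mathcal{D}^\times$ be a dual map of $\omega$. Suppose that $\omega$ is a Riesz-Fischer distribution map. Then $\theta$ is a Bessel distribution map.
   Context: A rigged Hilbert space $\mathcal{D}[t]\hookrightarrow\mathcal{H}\hookrightarrow\mathcal{D}^\times[t^\times]$ consists of a Hilbert space $\mathcal{H}$, a dense subspace $\mathcal{D}$ of $\mathcal{H}$ endowed with a locally convex topology $t$ finer than the topology induced by the Hilbert norm, and the conjugate dual $\mathcal{D}^\times$ of $\mathcal{D}[t]$ (the space of continuous conjugate linear functionals on $\mathcal{D}[t]$) with the strong dual topology $t^\times$; the arrows denote continuous injections with dense range, and $\mathcal{H}$ is identified with a subspace of $\mathcal{D}^\times$, so that the sesquilinear form $\langle\cdot|\cdot\rangle$ putting $\mathcal{D}$ and $\mathcal{D}^\times$ in duality extends the inner product of $\mathcal{H}$ (linear in the first variable). For $F\in\mathcal{D}^\times$ and $f\in\mathcal{D}$, $\langle F|f\rangle$ denotes the value of $F$ at $f$, and $\langle f|F\rangle:=\overline{\langle F|f\rangle}$. A map $\omega: X\to\mathcal{D}^\times$, $x\mapsto\omega_x$, is weakly measurable if for every $f\in\mathcal{D}$ the complex valued function $x\mapsto\langle f|\omega_x\rangle$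 is $\mu$-measurable. A weakly measurable map $\omega$ is: - a Bessel distribution map (Bessel map) if $\int_X|\langle f|\omega_x\rangle|^2\,d\mu<\infty$ for every $f\in\mathcal{D}$; - a Riesz-Fischer distribution map (Riesz-Fischer map) if for every $h\in L^2(X,\mu)$ there exists $f\in\mathcal{D}$ such that $\langle f|\omega_x\rangle=h(x)$ for $\mu$-a.e. $x\in X$. A dual map of a weakly measurable map $\omega$ is a weakly measurable map $\theta: X\to\mathcal{D}^\times$ such that for all $f,g\in\mathcal{D}$ the integral $\int_X\langle f|\theta_x\rangle\langle\omega_x|g\rangle\,d\mu$ exists with $\left|\int_X\langle f|\theta_x\rangle\langle\omega_x|g\rangle\,d\mu\right|<\infty$, and $\langle f|g\rangle=\int_X\langle f|\theta_x\rangle\langle\omega_x|g\rangle\,d\mu$. *)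

theory Defs
  imports "HOL-Analysis.Analysis"
begin

class complex_vector = real_vector +
  fixes scaleC :: "complex \<Rightarrow> 'a \<Rightarrow> 'a"  (infixr \<open>*\<^sub>C\<close> 75)
  assumes scaleC_add_right: "c *\<^sub>C (x + y) = c *\<^sub>C x + c *\<^sub>C y"
    and scaleC_add_left: "(c + d) *\<^sub>C x = c *\<^sub>C x + d *\<^sub>C x"
    and scaleC_scaleC: "c *\<^sub>C d *\<^sub>C x = (c * d) *\<^sub>C x"
    and scaleC_one: "1 *\<^sub>C x = x"
    and scaleR_scaleC: "r *\<^sub>R x = of_real r *\<^sub>C x"

global_interpretation complex_vector:
  vector_space "scaleC :: complex \<Rightarrow> 'a \<Rightarrow> 'a::complex_vector"
  by unfold_locales (rule scaleC_add_right scaleC_add_left scaleC_scaleC scaleC_one)+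

text \<open>The inner product is linear in the first variable. Positive definiteness is contained in
  \<open>cinner_self\<close>, which also says that the norm of the class \<^class>\<open>banach\<close> (and hence its
  metric and topology) is the one induced by the inner product.\<close>

class complex_hilbert_space = complex_vector + banach +
  fixes cinner :: "'a \<Rightarrow> 'a \<Rightarrow> complex"
  assumes cinner_commute: "cinner x y = cnj (cinner y x)"
    and cinner_add_left: "cinner (x + y) z = cinner x z + cinner y z"
    and cinner_scaleC_left: "cinner (c *\<^sub>C x) y = c * cinner x y"
    and cinner_self: "cinner x x = of_real ((norm x)\<^sup>2)"

text \<open>A topological vector space \<open>D[t]\<close> inside the
  type \<open>'a\<close> is given by its carrier \<open>D\<close> and an abstract topology \<open>t\<close> with \<open>topspace t = D\<close>.\<close>

definition locally_convex_topology :: "'a::complex_vector set \<Rightarrow> 'a topology \<Rightarrow> bool" where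
  "locally_convex_topology D t \<longleftrightarrow>
     topspace t = D \<and>
     continuous_map (prod_topology t t) t (\<lambda>(x, y). x + y) \<and>
     continuous_map (prod_topology (euclidean :: complex topology) t) t (\<lambda>(c, x). c *\<^sub>C x) \<and>
     (\<forall>U. openin t U \<and> 0 \<in> U \<longrightarrow> (\<exists>V. openin t V \<and> convex V \<and> 0 \<in> V \<and> V \<subseteq> U))"

definition bounded_in :: "'a::complex_vector set \<Rightarrow> 'a topology \<Rightarrow> 'a set \<Rightarrow> bool" where
  "bounded_in D t B \<longleftrightarrow> B \<subseteq> D \<and>
     (\<forall>U. openin t U \<and> 0 \<in> U \<longrightarrow> (\<exists>r>0. \<forall>c. cmod c \<ge> r \<longrightarrow> B \<subseteq> (\<lambda>x. c *\<^sub>C x) ` U))"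

text \<open>Functionals on \<open>D\<close> are represented by total functions that are \<^const>\<open>undefined\<close> outside
  \<open>D\<close>, so that equality in the conjugate dual is equality on \<open>D\<close>. The value \<open>\<langle>F|f\<rangle>\<close> is \<open>F f\<close>, and
  \<open>\<langle>f|F\<rangle>\<close> is \<open>cnj (F f)\<close>.\<close>

definition conj_dual :: "'a::complex_vector set \<Rightarrow> 'a topology \<Rightarrow> ('a \<Rightarrow> complex) set" where
  "conj_dual D t = {F \<in> extensional D.
     (\<forall>f\<in>D. \<forall>g\<in>D. F (f + g) = F f + F g) \<and>
     (\<forall>c. \<forall>f\<in>D. F (c *\<^sub>C f) = cnj c * F f) \<and>
     continuous_map t euclidean F}"

text \<open>The topology of uniform convergence on the nonempty bounded subsets of \<open>D[t]\<close>; a continuous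
  functional is bounded on each of them, so the suprema are finite.\<close>

definition strong_dual_topology :: "'a::complex_vector set \<Rightarrow> 'a topology \<Rightarrow> ('a \<Rightarrow> complex) topology"
  where
  "strong_dual_topology D t = topology_generated_by
     {{G \<in> conj_dual D t. (SUP f\<in>B. cmod (G f - F f)) < e} | F B e.
        F \<in> conj_dual D t \<and> bounded_in D t B \<and> B \<noteq> {} \<and> e > 0}"

definition hilbert_embedding ::
    "'a::complex_hilbert_space set \<Rightarrow> 'a \<Rightarrow> 'a \<Rightarrow> complex" where
  "hilbert_embedding D h = (\<lambda>f\<in>D. cinner h f)"

text \<open>The Hilbert space is the whole type \<open>'a\<close>. The last three conditions say that it embeds
  into the conjugate dual by a continuous injection with dense range; the conditions before them
  say the same of the inclusion of \<open>D[t]\<close> into the Hilbert space.\<close>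

definition rigged_hilbert_space :: "'a::complex_hilbert_space set \<Rightarrow> 'a topology \<Rightarrow> bool" where
  "rigged_hilbert_space D t \<longleftrightarrow>
     complex_vector.subspace D \<and>
     closure D = UNIV \<and>
     locally_convex_topology D t \<and>
     (\<forall>U. openin (top_of_set D) U \<longrightarrow> openin t U) \<and>
     inj (hilbert_embedding D) \<and>
     continuous_map euclidean (strong_dual_topology D t) (hilbert_embedding D) \<and>
     strong_dual_topology D t closure_of range (hilbert_embedding D) = conj_dual D t"

definition weakly_measurable_map ::
    "'a::complex_vector set \<Rightarrow> 'a topology \<Rightarrow> 'x measure \<Rightarrow> ('x \<Rightarrow> 'a \<Rightarrow> complex) \<Rightarrow> bool" where
  "weakly_measurable_map D t M \<omega> \<longleftrightarrow>
     \<omega> \<in> space M \<rightarrow> conj_dual D t \<and>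
     (\<forall>f\<in>D. (\<lambda>x. cnj (\<omega> x f)) \<in> borel_measurable M)"

definition square_integrable :: "'x measure \<Rightarrow> ('x \<Rightarrow> complex) \<Rightarrow> bool" where
  "square_integrable M h \<longleftrightarrow>
     h \<in> borel_measurable M \<and> (\<integral>\<^sup>+x. ennreal ((cmod (h x))\<^sup>2) \<partial>M) < \<infinity>"

definition bessel_map ::
    "'a::complex_vector set \<Rightarrow> 'a topology \<Rightarrow> 'x measure \<Rightarrow> ('x \<Rightarrow> 'a \<Rightarrow> complex) \<Rightarrow> bool" where
  "bessel_map D t M \<omega> \<longleftrightarrow>
     weakly_measurable_map D t M \<omega> \<and>
     (\<forall>f\<in>D. (\<integral>\<^sup>+x. ennreal ((cmod (cnj (\<omega> x f)))\<^sup>2) \<partial>M) < \<infinity>)"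

definition riesz_fischer_map ::
    "'a::complex_vector set \<Rightarrow> 'a topology \<Rightarrow> 'x measure \<Rightarrow> ('x \<Rightarrow> 'a \<Rightarrow> complex) \<Rightarrow> bool" where
  "riesz_fischer_map D t M \<omega> \<longleftrightarrow>
     weakly_measurable_map D t M \<omega> \<and>
     (\<forall>h. square_integrable M h \<longrightarrow> (\<exists>f\<in>D. AE x in M. cnj (\<omega> x f) = h x))"

text \<open>\<open>dual_map D t M \<omega> \<theta>\<close>: \<open>\<theta>\<close> is a dual map of \<open>\<omega>\<close>. That the integral exists and is finite means
  Lebesgue integrability; this has to be required separately, because the Bochner integral of a
  non-integrable function is 0.\<close>

definition dual_map ::
    "'a::complex_hilbert_space set \<Rightarrow> 'a topology \<Rightarrow> 'x measure \<Rightarrow>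
     ('x \<Rightarrow> 'a \<Rightarrow> complex) \<Rightarrow> ('x \<Rightarrow> 'a \<Rightarrow> complex) \<Rightarrow> bool" where
  "dual_map D t M \<omega> \<theta> \<longleftrightarrow>
     weakly_measurable_map D t M \<theta> \<and>
     (\<forall>f\<in>D. \<forall>g\<in>D.
        integrable M (\<lambda>x. cnj (\<theta> x f) * \<omega> x g) \<and>
        cinner f g = (\<integral>x. cnj (\<theta> x f) * \<omega> x g \<partial>M))"

end

theory Submission
  imports Defs
begin

text \<open>Since every \<open>h\<close> in \<open>L\<^sup>2\<close> is almost everywhere of the form \<open>\<langle>g|\<omega>\<^sub>x\<rangle>\<close>, the duality relation
  makes \<open>\<langle>f|\<theta>\<^sub>x\<rangle> h(x)\<close> integrable for every such \<open>h\<close>, and the converse of Hoelder's inequality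
  puts \<open>\<langle>f|\<theta>\<^sub>x\<rangle>\<close> in \<open>L\<^sup>2\<close>. For that converse, if \<open>u \<ge> 0\<close> were not square integrable, there would
  be sets \<open>F\<^sub>k\<close> such that \<open>c\<^sub>k\<close>, the integral of \<open>u\<^sup>2\<close> over \<open>F\<^sub>k\<close>, is finite and at least
  \<open>2\<^sup>k (k + 1)\<^sup>2\<close>. Then \<open>h = u \<surd>w\<close> with \<open>w = \<Sum>\<^sub>k 2\<^sup>-\<^sup>k \<chi>\<^sub>k / c\<^sub>k\<close>,
  \<open>\<chi>\<^sub>k\<close> being the indicator of \<open>F\<^sub>k\<close>, has \<open>\<integral> h\<^sup>2 = 2\<close>,
  while \<open>\<integral> u h \<ge> \<surd>(2\<^sup>-\<^sup>k c\<^sub>k) \<ge> k + 1\<close> for all \<open>k\<close>.\<close>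

lemma (in sigma_finite_measure) nn_integral_power2_finite_if_dual:
  fixes u :: "'a \<Rightarrow> real"
  assumes u [measurable]: "u \<in> borel_measurable M" and u_nonneg: "\<And>x. u x \<ge> 0"
    and dual: "\<And>h :: 'a \<Rightarrow> real. h \<in> borel_measurable M \<Longrightarrow> (\<And>x. h x \<ge> 0) \<Longrightarrow>
      (\<integral>\<^sup>+x. ennreal ((h x)\<^sup>2) \<partial>M) < \<infinity> \<Longrightarrow> (\<integral>\<^sup>+x. ennreal (u x * h x) \<partial>M) < \<infinity>"
  shows "(\<integral>\<^sup>+x. ennreal ((u x)\<^sup>2) \<partial>M) < \<infinity>"
proof (rule ccontr)
  assume contr: "\<not> ?thesis"
  \<comment> \<open>The integral of \<open>(u x)\<^sup>2\<close> over a set becomes its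
    \<open>N\<close>-measure. As this density is finite everywhere, \<open>N\<close> inherits
    sigma-finiteness, which supplies sets of finite yet arbitrarily large
    \<open>N\<close>-measure.\<close>
  define N where "N = density M (\<lambda>x. ennreal ((u x)\<^sup>2))"
  interpret N: sigma_finite_measure N
    unfolding N_def by (subst sigma_finite_iff_density_finite) auto
  have sets_N [measurable_cong]: "sets N = sets M"
    by (simp add: N_def)
  have "emeasure N (space M) = (\<integral>\<^sup>+x. ennreal ((u x)\<^sup>2) \<partial>M)"
    unfolding N_def by (subst emeasure_density) (auto intro!: nn_integral_cong)
  with contr have inf: "emeasure N (space M) = \<infinity>"
    by (simp add: less_top[symmetric])
  have "\<exists>Z \<in> sets M. emeasure N Z < \<infinity> \<and> ennreal (2 ^ k * (real k + 1)\<^sup>2) < emeasure N Z" for k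
    using N.approx_PInf_emeasure_with_finite[OF _ inf, of "2 ^ k * (real k + 1)\<^sup>2"]
    by (auto simp: sets_N)
  then obtain F where F [measurable]: "\<And>k. F k \<in> sets M"
    and F_fin: "\<And>k. emeasure N (F k) < \<infinity>"
    and F_large: "\<And>k. ennreal (2 ^ k * (real k + 1)\<^sup>2) < emeasure N (F k)"
    by metis
  define c where "c k = measure N (F k)" for k
  have c: "emeasure N (F k) = ennreal (c k)" for k
    using F_fin[of k] by (simp add: c_def emeasure_eq_ennreal_measure)
  have c_large: "2 ^ k * (real k + 1)\<^sup>2 < c k" for k
    using F_large[of k] by (simp add: c ennreal_less_iff)
  have c_ge_1: "c k \<ge> 1" for k
  proof -
    have "1 * 1 \<le> (2::real) ^ k * (real k + 1)\<^sup>2"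
      by (intro mult_mono) (auto simp: power2_eq_square algebra_simps)
    with c_large[of k] show ?thesis by linarith
  qed
  have integral_F: "(\<integral>\<^sup>+x. ennreal (a * indicator (F k) x * (u x)\<^sup>2) \<partial>M) = ennreal (a * c k)"
    if "a \<ge> 0" for a k
  proof -
    have "(\<integral>\<^sup>+x. ennreal (a * indicator (F k) x * (u x)\<^sup>2) \<partial>M)
        = (\<integral>\<^sup>+x. ennreal a * (ennreal ((u x)\<^sup>2) * indicator (F k) x) \<partial>M)"
      using that by (intro nn_integral_cong) (auto simp: indicator_def ennreal_mult)
    also have "\<dots> = ennreal a * emeasure N (F k)"
      by (simp add: nn_integral_cmult N_def emeasure_density)
    finally show ?thesis
      using that c_ge_1[of k] by (simp add: c ennreal_mult)
  qed
  \<comment> \<open>Dividing by \<open>c k\<close> makes the \<open>k\<close>-th term of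
    \<open>w\<close> contribute exactly \<open>(1/2) ^ k\<close> to the integral of
    \<open>(h x)\<^sup>2\<close>, and \<open>c k \<ge> 1\<close> gives a geometric majorant, so the
    series for \<open>w\<close> converges at every point.\<close>
  define a where "a k = (1/2) ^ k / c k" for k
  have a_pos: "a k > 0" for k
    using c_ge_1[of k] by (simp add: a_def)
  have a_le: "a k \<le> (1/2) ^ k" for k
    using c_ge_1[of k] by (simp add: a_def field_simps)
  have a_c: "a k * c k = (1/2) ^ k" for k
    using c_ge_1[of k] by (simp add: a_def)
  define w where "w x = (\<Sum>k. a k * indicator (F k) x)" for x
  have summable_w: "summable (\<lambda>k. a k * indicator (F k) x :: real)" for x
  proof (rule summable_comparison_test')
    show "summable (\<lambda>k. (1/2) ^ k :: real)" by (simp add: summable_geometric)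
  qed (use a_pos a_le in \<open>auto simp: indicator_def less_imp_le\<close>)
  have w_ge: "a k * indicator (F k) x \<le> w x" for k x
  proof -
    have "(\<Sum>j\<in>{k}. a j * indicator (F j) x) \<le> w x"
      unfolding w_def by (rule sum_le_suminf[OF summable_w])
        (auto intro!: mult_nonneg_nonneg less_imp_le[OF a_pos])
    then show ?thesis
      by (simp only: sum.insert sum.empty finite.emptyI empty_iff not_False_eq_True add_0_right)
  qed
  have w_nonneg: "w x \<ge> 0" for x
    using w_ge[of 0 x] a_pos[of 0] by (smt (verit) indicator_pos_le mult_nonneg_nonneg)
  have [measurable]: "w \<in> borel_measurable M"
    unfolding w_def by measurable
  define h where "h x = u x * sqrt (w x)" for x
  have [measurable]: "h \<in> borel_measurable M"
    unfolding h_def by measurable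
  have "(\<integral>\<^sup>+x. ennreal ((h x)\<^sup>2) \<partial>M)
      = (\<integral>\<^sup>+x. (\<Sum>k. ennreal (a k * indicator (F k) x * (u x)\<^sup>2)) \<partial>M)"
  proof (intro nn_integral_cong)
    fix x
    have "(h x)\<^sup>2 = (\<Sum>k. a k * indicator (F k) x * (u x)\<^sup>2)"
      using w_nonneg[of x] by (simp add: h_def power_mult_distrib w_def
        mult.commute[of _ "(u x)\<^sup>2"] suminf_mult[OF summable_w])
    then show "ennreal ((h x)\<^sup>2) = (\<Sum>k. ennreal (a k * indicator (F k) x * (u x)\<^sup>2))"
      using a_pos by (simp add: suminf_ennreal2 summable_mult2 summable_w less_imp_le)
  qed
  also have "\<dots> = (\<Sum>k. \<integral>\<^sup>+x. ennreal (a k * indicator (F k) x * (u x)\<^sup>2) \<partial>M)"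
    by (intro nn_integral_suminf) measurable
  also have "\<dots> = (\<Sum>k. ennreal ((1/2) ^ k))"
    by (simp add: integral_F a_pos less_imp_le a_c)
  also have "\<dots> < \<infinity>"
    by (subst suminf_ennreal2) (auto simp: summable_geometric)
  finally have "(\<integral>\<^sup>+x. ennreal (u x * h x) \<partial>M) < \<infinity>"
    by (intro dual) (auto simp: h_def u_nonneg w_nonneg)
  then obtain B where B: "B \<ge> 0" "(\<integral>\<^sup>+x. ennreal (u x * h x) \<partial>M) = ennreal B"
    by (cases "\<integral>\<^sup>+x. ennreal (u x * h x) \<partial>M") auto
  \<comment> \<open>Only the \<open>k\<close>-th term of \<open>w\<close> is kept:
    \<open>sqrt (w x)\<close> is at least \<open>sqrt (a k)\<close> on \<open>F k\<close>.\<close>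
  have "real k \<le> B" for k
  proof -
    have "ennreal (sqrt (a k) * c k)
        = (\<integral>\<^sup>+x. ennreal (sqrt (a k) * indicator (F k) x * (u x)\<^sup>2) \<partial>M)"
      using a_pos[of k] by (simp add: integral_F)
    also have "\<dots> \<le> (\<integral>\<^sup>+x. ennreal (u x * h x) \<partial>M)"
    proof (intro nn_integral_mono ennreal_leI)
      fix x
      have "sqrt (a k) * indicator (F k) x \<le> sqrt (w x)"
        using w_ge[of k x] w_nonneg[of x] by (auto simp: indicator_def)
      then have "sqrt (a k) * indicator (F k) x * (u x)\<^sup>2 \<le> sqrt (w x) * (u x)\<^sup>2"
        by (rule mult_right_mono) simp
      then show "sqrt (a k) * indicator (F k) x * (u x)\<^sup>2 \<le> u x * h x"
        by (simp add: h_def power2_eq_square mult_ac)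
    qed
    finally have le: "sqrt (a k) * c k \<le> B"
      using B by simp
    \<comment> \<open>The factor \<open>2 ^ k\<close> in \<open>c_large\<close> absorbs the
      \<open>(1/2) ^ k\<close> in \<open>a k * (c k)\<^sup>2 = (1/2) ^ k * c k\<close>, so a bound
      growing with \<open>k\<close> survives.\<close>
    have "(real k)\<^sup>2 \<le> (real k + 1)\<^sup>2"
      by (intro power_mono) auto
    also have "\<dots> \<le> (1/2) ^ k * c k"
      using c_large[of k] by (simp add: field_simps power_divide)
    also have "\<dots> = (sqrt (a k) * c k)\<^sup>2"
      using a_pos[of k] by (simp add: power_mult_distrib power2_eq_square flip: a_c)
    finally have "real k \<le> sqrt (a k) * c k"
      by (rule power2_le_imp_le) (use a_pos[of k] c_ge_1[of k] in auto)
    with le show ?thesis by simp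
  qed
  moreover obtain k where "B < real k"
    using reals_Archimedean2 by blast
  ultimately show False
    by (meson not_less)
qed

theorem proposition3p10:
  fixes D :: "'h::complex_hilbert_space set" and t :: "'h topology"
    and M :: "'x measure"
    and \<omega> \<theta> :: "'x \<Rightarrow> 'h \<Rightarrow> complex"
  assumes "rigged_hilbert_space D t"
    and "sigma_finite_measure M"
    and "weakly_measurable_map D t M \<omega>"
    and "dual_map D t M \<omega> \<theta>"
    and "riesz_fischer_map D t M \<omega>"
  shows "bessel_map D t M \<theta>"
proof -
  interpret sigma_finite_measure M by fact
  have wm: "weakly_measurable_map D t M \<theta>"
    using assms(4) by (simp add: dual_map_def)
  \<comment> \<open>The modulus of \<open>cnj (\<theta> x f)\<close> plays the role of
    \<open>u\<close>; the Riesz-Fischer property realises each test function \<open>h\<close> by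
    some \<open>g\<close> in \<open>D\<close>.\<close>
  have "(\<integral>\<^sup>+x. ennreal ((cmod (cnj (\<theta> x f)))\<^sup>2) \<partial>M) < \<infinity>" if f: "f \<in> D" for f
  proof (rule nn_integral_power2_finite_if_dual)
    have [measurable]: "(\<lambda>x. cnj (\<theta> x f)) \<in> borel_measurable M"
      using wm f by (simp add: weakly_measurable_map_def)
    show "(\<lambda>x. cmod (cnj (\<theta> x f))) \<in> borel_measurable M"
      by measurable
    fix h :: "'x \<Rightarrow> real"
    assume h [measurable]: "h \<in> borel_measurable M" and h_nonneg: "\<And>x. h x \<ge> 0"
      and h_fin: "(\<integral>\<^sup>+x. ennreal ((h x)\<^sup>2) \<partial>M) < \<infinity>"
    have "square_integrable M (\<lambda>x. complex_of_real (h x))"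
      using h_fin by (simp add: square_integrable_def)
    then obtain g where g: "g \<in> D" "AE x in M. cnj (\<omega> x g) = complex_of_real (h x)"
      using assms(5) unfolding riesz_fischer_map_def by blast
    \<comment> \<open>Lebesgue integrability is absolute, and passing to the modulus removes the
      phase of \<open>\<theta> x f\<close> and the conjugation on \<open>\<omega> x g\<close>,
      leaving the real product that the converse of Hoelder's inequality needs.\<close>
    have "integrable M (\<lambda>x. cnj (\<theta> x f) * \<omega> x g)"
      using assms(4) f g(1) by (simp add: dual_map_def)
    then have "(\<integral>\<^sup>+x. ennreal (cmod (cnj (\<theta> x f) * \<omega> x g)) \<partial>M) < \<infinity>"
      by (simp add: integrable_iff_bounded)
    also have "(\<integral>\<^sup>+x. ennreal (cmod (cnj (\<theta> x f) * \<omega> x g)) \<partial>M)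
        = (\<integral>\<^sup>+x. ennreal (cmod (cnj (\<theta> x f)) * h x) \<partial>M)"
    proof (rule nn_integral_cong_AE, use g(2) in eventually_elim)
      fix x assume "cnj (\<omega> x g) = complex_of_real (h x)"
      then have "cmod (\<omega> x g) = h x"
        using h_nonneg[of x] by (metis complex_mod_cnj norm_of_real abs_of_nonneg)
      then show "ennreal (cmod (cnj (\<theta> x f) * \<omega> x g)) = ennreal (cmod (cnj (\<theta> x f)) * h x)"
        by (simp add: norm_mult)
    qed
    finally show "(\<integral>\<^sup>+x. ennreal (cmod (cnj (\<theta> x f)) * h x) \<partial>M) < \<infinity>" .
  qed simp
  with wm show ?thesis
    by (simp add: bessel_map_def)
qed

end
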